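(* Let $\Lambda$ be a real-valued function on $[0,4]$. Suppose that for every $\varepsilon>0$ there is an integer $p_1=p_1(\varepsilon)>0$ such that $$\sup_{j\in\mathbb{F}_p^\times}\Lambda_{S_j}(\vartheta)\le\Lambda(\vartheta)+\varepsilon,\qquad 0\le\vartheta\le4,$$ for every odd prime $p\ge p_1$. Assume also that $\varphi:=\sup_{0<\vartheta\le4}\Lambda(\vartheta)/\vartheta<1/2$. Then, for every $r>\frac{2}{1-2\varphi}$, one has $$R_{S_j}^*(2\to r)\lesssim_{r,\varphi}1$$ uniformly for all odd primes $p$ and all $j\in\mathbb{F}_p^\times$; that is, there is a constant $C=C(r,\varphi)$ such that $\|(f\,d\sigma_j)^\vee\|_{L^r(\mathbb{F}_p^4)}\le C\|f\|_{L^2(S_j,d\sigma_j)}$ for all odd primes $p$, all $j\in\mathbb{F}_p^\times$ and all $f:S_j\to\mathbb{C}$.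
   Context: For an odd prime $p$, let $\chi(y)=e^{2\pi i y/p}$ on $\mathbb{F}_p$, $Q_4(x)=x_1^2+\dots+x_4^2$, and for $j\in\mathbb{F}_p^\times$ let $S_j=\{x\in\mathbb{F}_p^4:Q_4(x)=j\}$ with uniform probability measure $d\sigma_j$, so $\|f\|_{L^2(S_j,d\sigma_j)}=\big(\frac1{|S_j|}\sum_{\xi\in S_j}|f(\xi)|^2\big)^{1/2}$. Let $(f\,d\sigma_j)^\vee(x)=\frac1{|S_j|}\sum_{y\in S_j}f(y)\chi(y\cdot x)$. The spaces $L^r(\mathbb{F}_p^4)$ and $L^2(E)$ ($E\subseteq\mathbb{F}_p^4$) use counting measure. For $0\le\vartheta\le4$, $\Lambda_{S_j}(\vartheta)$ is the infimum of all $\lambda\ge0$ such that for every $E\subseteq\mathbb{F}_p^4$ with $1\le|E|\le p^\vartheta$ and every $f:S_j\to\mathbb{C}$, $\|(f\,d\sigma_j)^\vee\|_{L^2(E)}\le p^\lambda\|f\|_{L^2(S_j,d\sigma_j)}$. Equivalently (by duality), it is the infimum of $\lambda\ge0$ such that for every such $E$ and every $g$ supported on $E$, $\|\widehat g\|_{L^2(S_j,d\sigma_j)}\le p^\lambda\|g\|_{L^2(\mathbb{F}_p^4)}$, where $\widehat g(\xi)=\sum_x g(x)\chi(-x\cdot\xi)$. *)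

theory Defs
  imports "HOL-Analysis.Analysis" "HOL-Number_Theory.Cong"
begin

text \<open>
  The prime \<open>p\<close> is quantified over in the theorem, so the prime field is modelled by the residues
  \<open>{0..<p}\<close> in \<open>int\<close> with arithmetic modulo \<open>p\<close>, and its fourth power by a finite subset of
  \<open>int ^ 4\<close>. Functions on a subset of this space are total functions on \<open>int ^ 4\<close> of which only
  the values on the subset are ever used.
\<close>

definition Fp4 :: "nat \<Rightarrow> (int ^ 4) set" where
  "Fp4 p = {x. \<forall>i. x $ i \<in> {0..<int p}}"

definition Fp_units :: "nat \<Rightarrow> int set" where
  "Fp_units p = {1..<int p}"

text \<open>\<open>chi p y\<close> depends only on \<open>y\<close> modulo \<open>p\<close>, so its argument need not be reduced.\<close>

definition chi :: "nat \<Rightarrow> int \<Rightarrow> complex" where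
  "chi p y = exp (2 * of_real pi * \<i> * of_int y / of_nat p)"

definition dot4 :: "int ^ 4 \<Rightarrow> int ^ 4 \<Rightarrow> int" where
  "dot4 x y = (\<Sum>i\<in>UNIV. x $ i * y $ i)"

definition Q4 :: "int ^ 4 \<Rightarrow> int" where
  "Q4 x = (\<Sum>i\<in>UNIV. (x $ i)\<^sup>2)"

definition sphere4 :: "nat \<Rightarrow> int \<Rightarrow> (int ^ 4) set" where
  "sphere4 p j = {x \<in> Fp4 p. [Q4 x = j] (mod int p)}"

text \<open>The \<open>L\<^sup>r\<close> norm on a finite set with counting measure, for a finite exponent \<open>r > 0\<close>.\<close>

definition Lnorm :: "real \<Rightarrow> (int ^ 4) set \<Rightarrow> (int ^ 4 \<Rightarrow> complex) \<Rightarrow> real" where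
  "Lnorm r E f = (\<Sum>x\<in>E. cmod (f x) powr r) powr (1 / r)"

text \<open>The \<open>L\<^sup>2\<close> norm for the uniform probability measure on the sphere.\<close>

definition sphere_L2norm :: "nat \<Rightarrow> int \<Rightarrow> (int ^ 4 \<Rightarrow> complex) \<Rightarrow> real" where
  "sphere_L2norm p j f =
     sqrt (1 / real (card (sphere4 p j)) * (\<Sum>\<xi>\<in>sphere4 p j. (cmod (f \<xi>))\<^sup>2))"

text \<open>The extension operator, mapping \<open>f\<close> to the inverse Fourier transform of \<open>f d\<sigma>\<close>.\<close>

definition extension :: "nat \<Rightarrow> int \<Rightarrow> (int ^ 4 \<Rightarrow> complex) \<Rightarrow> int ^ 4 \<Rightarrow> complex" where
  "extension p j f x =
     1 / of_nat (card (sphere4 p j)) * (\<Sum>y\<in>sphere4 p j. f y * chi p (dot4 y x))"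

definition Lambda_sphere :: "nat \<Rightarrow> int \<Rightarrow> real \<Rightarrow> real" where
  "Lambda_sphere p j \<theta> = Inf {l. 0 \<le> l \<and>
     (\<forall>E f. E \<subseteq> Fp4 p \<and> 1 \<le> card E \<and> real (card E) \<le> real p powr \<theta> \<longrightarrow>
        Lnorm 2 E (extension p j f) \<le> real p powr l * sphere_L2norm p j f)}"

end

theory Submission
  imports Defs
begin

text \<open>
  Write \<open>F\<close> for the extension of \<open>f\<close> and \<open>N\<close> for the \<open>L\<^sup>2\<close> norm of \<open>f\<close>. The exponent \<open>\<Lambda>\<close> controls
  square means of \<open>F\<close> over sets \<open>E\<close>, but only up to factors \<open>p powr \<epsilon>\<close>; the point is to get rid of
  this loss. If \<open>E\<close> has at least \<open>p\<close> elements, then \<open>p powr \<epsilon>\<close> is at most \<open>card E powr \<epsilon>\<close>, so the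
  hypothesis gives \<open>\<parallel>F\<parallel>\<^bsub>L2(E)\<^esub> \<le> card E powr s * N\<close> for any prescribed \<open>s > \<phi>\<close> and all large \<open>p\<close>.
  If \<open>E\<close> has at most \<open>p\<close> elements, then Fourier decay of the sphere measure takes over: away from the
  origin the transform of \<open>d\<sigma>\<close> is \<open>O(1 / p)\<close>, so the functions \<open>y \<mapsto> \<chi>(y \<cdot> x)\<close>, \<open>x \<in> E\<close>, are almost
  orthogonal on the sphere and \<open>\<parallel>F\<parallel>\<^bsub>L2(E)\<^esub> \<le> 2 * N\<close>. Up to
  normalisation the transform is a mean over a multiplier \<open>t\<close> of products of four Gauss sums of
  modulus \<open>sqrt p\<close>; in dimension four the triangle inequality in \<open>t\<close> leaves a gain of \<open>1 / p\<close>. The finitely many small primes cost only a constant. Together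
  (\<open>mean_square_bound_of_exponent\<close>) this yields \<open>\<parallel>F\<parallel>\<^bsub>L2(E)\<^esub> \<le> B * card E powr s * N\<close> for all
  nonempty \<open>E\<close>, with \<open>B\<close> independent of \<open>p\<close>.

  Such a bound for all subsets says that the \<open>k\<close>-th largest value of \<open>cmod F\<close> is at most
  \<open>B * k powr (s - 1/2) * N\<close> (\<open>sum_powr_le_of_mean_squares\<close>). Its \<open>r\<close>-th powers are summable in \<open>k\<close>
  as soon as \<open>r * (1/2 - s) > 1\<close>, and \<open>r > 2 / (1 - 2 * \<phi>)\<close> is exactly what allows a choice of
  \<open>s > \<phi>\<close> with this property.
\<close>

section \<open>Quadratic exponential sums\<close>

lemma chi_add: "chi p (a + b) = chi p a * chi p b"
  by (simp add: chi_def exp_add [symmetric] add_divide_distrib ring_distribs)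

lemma chi_0 [simp]: "chi p 0 = 1"
  by (simp add: chi_def)

lemma norm_chi [simp]: "cmod (chi p a) = 1"
proof -
  have "chi p a = exp (\<i> * of_real (2 * pi * real_of_int a / real p))"
    by (simp add: chi_def mult_ac)
  then show ?thesis
    by (metis norm_exp_i_times)
qed

lemma cnj_chi: "cnj (chi p a) = chi p (- a)"
  by (simp add: chi_def exp_cnj)

lemma chi_eq_1_iff:
  assumes "p > 0"
  shows "chi p a = 1 \<longleftrightarrow> int p dvd a"
proof -
  have e: "2 * of_real pi * \<i> * of_int a / of_nat p = \<i> * of_real (2 * pi * real_of_int a / real p)"
    by (simp add: mult_ac)
  have "chi p a = 1 \<longleftrightarrow> (\<exists>n::int. 2 * pi * real_of_int a / real p = of_int (2 * n) * pi)"
    unfolding chi_def exp_eq_1 e by simp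
  also have "\<dots> \<longleftrightarrow> (\<exists>n::int. real_of_int a = real_of_int (int p * n))"
    using assms by (simp add: field_simps)
  also have "\<dots> \<longleftrightarrow> int p dvd a"
    unfolding dvd_def of_int_eq_iff by simp
  finally show ?thesis .
qed

lemma chi_mod:
  assumes "p > 0"
  shows "chi p (a mod int p) = chi p a"
proof -
  have "chi p a = chi p (int p * (a div int p)) * chi p (a mod int p)"
    by (simp add: chi_add [symmetric])
  then show ?thesis
    using chi_eq_1_iff [OF assms, of "int p * (a div int p)"] by simp
qed

lemma chi_cong:
  assumes "p > 0" "[a = b] (mod int p)"
  shows "chi p a = chi p b"
  using chi_mod [OF assms(1)] assms(2) unfolding cong_def by metis

lemma chi_power: "chi p (a * int n) = chi p a ^ n"
  by (induction n) (simp_all add: chi_add ring_distribs)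

lemma sum_chi:
  assumes "p > 0"
  shows "(\<Sum>v\<in>{0..<int p}. chi p (a * v)) = (if int p dvd a then of_nat p else 0)"
proof -
  have "(\<Sum>v\<in>{0..<int p}. chi p (a * v)) = (\<Sum>n<p. chi p a ^ n)"
    by (rule sum.reindex_bij_witness [of _ int nat]) (auto simp flip: chi_power)
  also have "\<dots> = (if int p dvd a then of_nat p else 0)"
  proof (cases "int p dvd a")
    case True
    then have "chi p a = 1" using chi_eq_1_iff [OF assms] by simp
    then show ?thesis using True by simp
  next
    case False
    then have "chi p a \<noteq> 1" using chi_eq_1_iff [OF assms] by simp
    moreover have "chi p a ^ p = 1"
      using chi_eq_1_iff [OF assms, of "a * int p"] by (simp add: chi_power)
    ultimately show ?thesis
      using False geometric_sum [of "chi p a" p] by simp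
  qed
  finally show ?thesis .
qed

lemma sum_residues_shift:
  fixes g :: "int \<Rightarrow> 'a::comm_monoid_add"
  assumes "p > 0" "\<And>u. g (u mod int p) = g u"
  shows "(\<Sum>u\<in>{0..<int p}. g u) = (\<Sum>h\<in>{0..<int p}. g (v + h))"
proof (rule sum.reindex_bij_witness
        [of _ "\<lambda>h. (v + h) mod int p" "\<lambda>u. (u - v) mod int p"])
  fix u
  have "g (v + (u - v) mod int p) = g ((v + (u - v) mod int p) mod int p)"
    by (simp only: assms(2))
  also have "\<dots> = g u"
    by (simp add: mod_add_right_eq assms(2))
  finally show "g (v + (u - v) mod int p) = g u" .
qed (use assms(1) in \<open>auto simp: mod_simps\<close>)

text \<open>
  In \<open>\<bar>G\<bar>\<^sup>2 = \<Sum>u v. \<dots>\<close> the substitution \<open>u = v + h\<close> makes the exponent linear in \<open>v\<close> with coefficient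
  \<open>2 * t * h\<close>; by orthogonality only \<open>h = 0\<close> survives, because \<open>2 * t\<close> is invertible.
\<close>

lemma norm_gauss_sum:
  assumes "prime p" "odd p" "\<not> int p dvd t"
  shows "cmod (\<Sum>u\<in>{0..<int p}. chi p (t * u\<^sup>2 + b * u)) = sqrt (real p)"
proof -
  let ?R = "{0..<int p}"
  let ?G = "\<Sum>u\<in>?R. chi p (t * u\<^sup>2 + b * u)"
  have p0: "p > 0" using assms(1) by (simp add: prime_gt_0_nat)
  have pi: "prime (int p)" using assms(1) by simp
  have n2: "\<not> int p dvd 2"
  proof
    assume "int p dvd 2"
    then have "p dvd 2" using int_dvd_int_iff [of p 2] by simp
    then have "p = 2" using assms(1) by (simp add: primes_dvd_imp_eq)
    then show False using assms(2) by simp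
  qed
  have shift: "(\<Sum>u\<in>?R. chi p (t * u\<^sup>2 + b * u)) = (\<Sum>h\<in>?R. chi p (t * (v + h)\<^sup>2 + b * (v + h)))" for v
    by (rule sum_residues_shift [OF p0])
       (intro chi_cong [OF p0] cong_add cong_mult cong_pow cong_refl, simp_all add: cong_def)
  have "of_real ((cmod ?G)\<^sup>2) = ?G * cnj ?G"
    by (rule complex_norm_square)
  also have "\<dots> = (\<Sum>v\<in>?R. ?G * cnj (chi p (t * v\<^sup>2 + b * v)))"
    by (simp only: cnj_sum sum_distrib_left)
  also have "\<dots> = (\<Sum>v\<in>?R. \<Sum>h\<in>?R. chi p (t * (v + h)\<^sup>2 + b * (v + h)) * cnj (chi p (t * v\<^sup>2 + b * v)))"
    unfolding sum_distrib_right [symmetric] using shift by simp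
  also have "\<dots> = (\<Sum>v\<in>?R. \<Sum>h\<in>?R. chi p (t * h\<^sup>2 + b * h) * chi p ((2 * t * h) * v))"
    by (simp add: cnj_chi chi_add [symmetric] power2_eq_square algebra_simps)
  also have "\<dots> = (\<Sum>h\<in>?R. chi p (t * h\<^sup>2 + b * h) * (\<Sum>v\<in>?R. chi p ((2 * t * h) * v)))"
    by (subst sum.swap) (simp add: sum_distrib_left)
  also have "\<dots> = (\<Sum>h\<in>?R. if h = 0 then of_nat p else 0)"
  proof (intro sum.cong refl)
    fix h assume h: "h \<in> ?R"
    have "int p dvd 2 * t * h \<longleftrightarrow> int p dvd h"
      using pi n2 assms(3) by (simp add: prime_dvd_mult_iff)
    also have "\<dots> \<longleftrightarrow> h = 0"
      using h zdvd_not_zless by force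
    finally show "chi p (t * h\<^sup>2 + b * h) * (\<Sum>v\<in>?R. chi p ((2 * t * h) * v)) =
        (if h = 0 then of_nat p else 0)"
      unfolding sum_chi [OF p0] by simp
  qed
  also have "\<dots> = of_real (real p)"
    using p0 by simp
  finally have "(cmod ?G)\<^sup>2 = real p"
    by (simp only: of_real_eq_iff)
  then show ?thesis
    by (rule real_sqrt_unique [symmetric]) simp
qed

section \<open>Fourier decay of the sphere measure\<close>

lemma bij_betw_Fp4: "bij_betw vec_lambda (PiE UNIV (\<lambda>_. {0..<int p})) (Fp4 p)"
  by (rule bij_betw_byWitness [where f' = vec_nth]) (auto simp: Fp4_def PiE_def Pi_def)

lemma finite_Fp4 [simp]: "finite (Fp4 p)"
  using bij_betw_finite [OF bij_betw_Fp4, of p] by (simp add: finite_PiE)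

lemma finite_subset_Fp4: "E \<subseteq> Fp4 p \<Longrightarrow> finite E"
  using finite_subset [OF _ finite_Fp4] .

lemma card_Fp4: "card (Fp4 p) = p ^ 4"
  using bij_betw_same_card [OF bij_betw_Fp4, of p] by (simp add: card_PiE)

lemma finite_sphere4 [simp]: "finite (sphere4 p j)"
  by (simp add: sphere4_def)

lemma sum_prod_Fp4:
  fixes g :: "4 \<Rightarrow> int \<Rightarrow> 'a::comm_semiring_1"
  shows "(\<Sum>y\<in>Fp4 p. \<Prod>i\<in>UNIV. g i (y $ i)) = (\<Prod>i\<in>UNIV. \<Sum>u\<in>{0..<int p}. g i u)"
  using sum.reindex_bij_betw [OF bij_betw_Fp4, of "\<lambda>y. \<Prod>i\<in>UNIV. g i (y $ i)" p]
  by (simp add: prod_sum_PiE)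

lemma chi_sum: "finite I \<Longrightarrow> chi p (\<Sum>i\<in>I. a i) = (\<Prod>i\<in>I. chi p (a i))"
  by (induction I rule: finite_induct) (simp_all add: chi_add)

text \<open>
  Detecting the equation \<open>Q4 y = j\<close> by orthogonality, with a multiplier \<open>t\<close>, turns the sum over the
  sphere into a sum over the whole space, which factors into four one-dimensional sums. The
  multiplier \<open>t = 0\<close> gives the main term, present only at the origin; each of the fewer than \<open>p\<close>
  others contributes four Gauss sums, hence at most \<open>p\<^sup>2\<close>.
\<close>

lemma sphere_exponential_sum:
  assumes "prime p" "odd p"
  shows "cmod (of_nat p * (\<Sum>y\<in>sphere4 p j. chi p (dot4 y x)) -
               (if \<forall>i. int p dvd x $ i then of_nat p ^ 4 else 0)) \<le> real p ^ 3"
proof -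
  let ?R = "{0..<int p}"
  define G where "G t i = (\<Sum>u\<in>?R. chi p (t * u\<^sup>2 + x $ i * u))" for t i
  have p0: "p > 0" using assms(1) by (simp add: prime_gt_0_nat)
  have "of_nat p * (\<Sum>y\<in>sphere4 p j. chi p (dot4 y x)) =
      (\<Sum>y\<in>Fp4 p. (if [Q4 y = j] (mod int p) then of_nat p else 0) * chi p (dot4 y x))"
    unfolding sphere4_def by (subst sum.inter_filter) (auto simp: sum_distrib_left intro!: sum.cong)
  also have "\<dots> = (\<Sum>y\<in>Fp4 p. \<Sum>t\<in>?R. chi p ((Q4 y - j) * t) * chi p (dot4 y x))"
    unfolding sum_distrib_right [symmetric] sum_chi [OF p0] by (simp add: cong_iff_dvd_diff)
  also have "\<dots> = (\<Sum>t\<in>?R. \<Sum>y\<in>Fp4 p. chi p ((Q4 y - j) * t) * chi p (dot4 y x))"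
    by (rule sum.swap)
  also have "\<dots> = (\<Sum>t\<in>?R. chi p (- (t * j)) * (\<Prod>i\<in>UNIV. G t i))"
  proof (rule sum.cong [OF refl])
    fix t
    have "chi p ((Q4 y - j) * t) * chi p (dot4 y x) =
        chi p (- (t * j)) * (\<Prod>i\<in>UNIV. chi p (t * (y $ i)\<^sup>2 + x $ i * y $ i))" for y
    proof -
      have "(Q4 y - j) * t + dot4 y x = - (t * j) + (\<Sum>i\<in>UNIV. t * (y $ i)\<^sup>2 + x $ i * y $ i)"
        by (simp add: Q4_def dot4_def sum.distrib sum_distrib_left algebra_simps)
      then show ?thesis
        by (simp only: chi_add [symmetric] chi_sum [OF finite, symmetric])
    qed
    then show "(\<Sum>y\<in>Fp4 p. chi p ((Q4 y - j) * t) * chi p (dot4 y x)) =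
        chi p (- (t * j)) * (\<Prod>i\<in>UNIV. G t i)"
      by (simp add: G_def sum_distrib_left [symmetric]
            sum_prod_Fp4 [where g = "\<lambda>i u. chi p (t * u\<^sup>2 + x $ i * u)"])
  qed
  also have "\<dots> = (\<Prod>i\<in>UNIV. G 0 i) + (\<Sum>t\<in>?R - {0}. chi p (- (t * j)) * (\<Prod>i\<in>UNIV. G t i))"
    using p0 by (subst sum.remove [of _ 0]) auto
  also have "(\<Prod>i\<in>UNIV. G 0 i) = (if \<forall>i. int p dvd x $ i then of_nat p ^ 4 else 0)"
    unfolding G_def by (auto simp: sum_chi [OF p0] intro: prod_zero)
  finally have eq: "of_nat p * (\<Sum>y\<in>sphere4 p j. chi p (dot4 y x)) -
      (if \<forall>i. int p dvd x $ i then of_nat p ^ 4 else 0) =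
      (\<Sum>t\<in>?R - {0}. chi p (- (t * j)) * (\<Prod>i\<in>UNIV. G t i))"
    by simp
  have "cmod (\<Sum>t\<in>?R - {0}. chi p (- (t * j)) * (\<Prod>i\<in>UNIV. G t i)) \<le> (\<Sum>t\<in>?R - {0}. real p ^ 2)"
  proof (rule sum_norm_le)
    fix t assume t: "t \<in> ?R - {0}"
    then have "\<not> int p dvd t"
      using zdvd_not_zless by force
    then have "cmod (G t i) = sqrt (real p)" for i
      unfolding G_def by (rule norm_gauss_sum [OF assms])
    then have "cmod (chi p (- (t * j)) * (\<Prod>i\<in>UNIV. G t i)) = sqrt (real p) ^ 4"
      by (simp add: norm_mult prod_norm [symmetric])
    also have "\<dots> = (sqrt (real p) ^ 2) ^ 2"
      by (simp only: power_mult [symmetric]) simp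
    finally show "cmod (chi p (- (t * j)) * (\<Prod>i\<in>UNIV. G t i)) \<le> real p ^ 2"
      by simp
  qed
  also have "\<dots> \<le> real p * real p ^ 2"
    using p0 by (auto intro!: mult_right_mono)
  finally show ?thesis
    unfolding eq by (simp add: power3_eq_cube power2_eq_square)
qed

lemma norm_sphere_sum_le:
  assumes "prime p" "odd p" "\<not> int p dvd x $ i"
  shows "cmod (\<Sum>y\<in>sphere4 p j. chi p (dot4 y x)) \<le> real p ^ 2"
proof -
  have p0: "p > 0" using assms(1) by (simp add: prime_gt_0_nat)
  have x: "\<not> (\<forall>i. int p dvd x $ i)"
    using assms(3) by blast
  have "real p * cmod (\<Sum>y\<in>sphere4 p j. chi p (dot4 y x)) \<le> real p * real p ^ 2"
    using sphere_exponential_sum [OF assms(1,2), where j = j and x = x]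
    unfolding if_not_P [OF x] by (simp add: norm_mult power3_eq_cube power2_eq_square mult.assoc)
  then show ?thesis
    using p0 by simp
qed

lemma card_sphere4_ge:
  assumes "prime p" "odd p"
  shows "real p ^ 3 \<le> 2 * real (card (sphere4 p j))"
proof -
  have p3: "p \<ge> 3"
    using assms prime_ge_2_nat [of p] by (cases "p = 2") auto
  let ?N = "real (card (sphere4 p j))"
  have "cmod (of_nat p * of_nat (card (sphere4 p j)) - of_nat p ^ 4) \<le> real p ^ 3"
    using sphere_exponential_sum [OF assms, where j = j and x = 0] by (simp add: dot4_def)
  also have "of_nat p * of_nat (card (sphere4 p j)) - of_nat p ^ 4 = complex_of_real (real p * ?N - real p ^ 4)"
    by simp
  finally have "\<bar>real p * ?N - real p ^ 4\<bar> \<le> real p ^ 3"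
    by (simp only: norm_of_real)
  then have "real p * real p ^ 3 \<le> real p * ?N + real p ^ 3"
    by (simp add: power_def abs_le_iff numeral_eq_Suc)
  also have "2 * real p ^ 3 \<le> real p * real p ^ 3"
    using p3 by (intro mult_right_mono) auto
  then have "real p ^ 3 \<le> real p * real p ^ 3 / 2" by simp
  finally have "real p * real p ^ 3 \<le> real p * (2 * ?N)"
    by simp
  then show ?thesis
    using p3 by simp
qed

section \<open>Square mean estimates on small sets\<close>

text \<open>
  The bound on the operator with kernel \<open>k\<close> passes to its adjoint \<open>G\<close>, whose square sum is a
  quadratic form with the Gram matrix of the functions \<open>k _ x\<close>. Its diagonal contributes \<open>D\<close>, and its
  off-diagonal part is at most \<open>\<eta> * (\<Sum>x\<in>E. \<bar>F x\<bar>)\<^sup>2\<close>, which loses \<open>card E\<close> by Cauchy-Schwarz. Testing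
  against \<open>F\<close> itself leaves an inequality of the form \<open>A\<^sup>2 \<le> K * A\<close> for \<open>A = \<Sum>x\<in>E. \<bar>F x\<bar>\<^sup>2\<close>.
\<close>

lemma almost_orthogonality:
  fixes k :: "'b \<Rightarrow> 'a \<Rightarrow> complex"
  assumes "finite E" "0 \<le> D" "0 \<le> \<eta>"
    and diag: "\<And>x. x \<in> E \<Longrightarrow> cmod (\<Sum>y\<in>S. k y x * cnj (k y x)) \<le> D"
    and offdiag: "\<And>x x'. x \<in> E \<Longrightarrow> x' \<in> E \<Longrightarrow> x \<noteq> x' \<Longrightarrow>
        cmod (\<Sum>y\<in>S. k y x * cnj (k y x')) \<le> \<eta>"
  shows "(\<Sum>x\<in>E. (cmod (\<Sum>y\<in>S. f y * k y x))\<^sup>2) \<le> (D + \<eta> * real (card E)) * (\<Sum>y\<in>S. (cmod (f y))\<^sup>2)"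
proof -
  define F where "F x = (\<Sum>y\<in>S. f y * k y x)" for x
  define G where "G y = (\<Sum>x\<in>E. cnj (F x) * k y x)" for y
  define A where "A = (\<Sum>x\<in>E. (cmod (F x))\<^sup>2)"
  have A0: "A \<ge> 0"
    unfolding A_def by (simp add: sum_nonneg)
  have "of_real A = (\<Sum>x\<in>E. F x * cnj (F x))"
    unfolding A_def of_real_sum complex_norm_square ..
  also have "\<dots> = (\<Sum>x\<in>E. \<Sum>y\<in>S. f y * (cnj (F x) * k y x))"
    by (subst F_def) (simp add: sum_distrib_left sum_distrib_right mult_ac)
  also have "\<dots> = (\<Sum>y\<in>S. f y * G y)"
    unfolding G_def sum_distrib_left by (rule sum.swap)
  finally have dual: "of_real A = (\<Sum>y\<in>S. f y * G y)" .
  have "A = cmod (of_real A)"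
    using A0 by simp
  also have "\<dots> \<le> (\<Sum>y\<in>S. cmod (f y) * cmod (G y))"
    unfolding dual by (rule order_trans [OF norm_sum]) (simp add: norm_mult)
  finally have "A\<^sup>2 \<le> (\<Sum>y\<in>S. cmod (f y) * cmod (G y))\<^sup>2"
    using A0 by (intro power_mono) auto
  also have "\<dots> \<le> (\<Sum>y\<in>S. (cmod (f y))\<^sup>2) * (\<Sum>y\<in>S. (cmod (G y))\<^sup>2)"
    by (rule Cauchy_Schwarz_ineq_sum)
  finally have CS: "A\<^sup>2 \<le> (\<Sum>y\<in>S. (cmod (f y))\<^sup>2) * (\<Sum>y\<in>S. (cmod (G y))\<^sup>2)" .
  have "of_real (\<Sum>y\<in>S. (cmod (G y))\<^sup>2) = (\<Sum>y\<in>S. G y * cnj (G y))"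
    unfolding of_real_sum complex_norm_square ..
  also have "\<dots> = (\<Sum>y\<in>S. \<Sum>x\<in>E. \<Sum>x'\<in>E. cnj (F x) * F x' * (k y x * cnj (k y x')))"
    unfolding G_def cnj_sum sum_product by (simp add: mult_ac)
  also have "\<dots> = (\<Sum>x\<in>E. \<Sum>y\<in>S. \<Sum>x'\<in>E. cnj (F x) * F x' * (k y x * cnj (k y x')))"
    by (rule sum.swap)
  also have "\<dots> = (\<Sum>x\<in>E. \<Sum>x'\<in>E. cnj (F x) * F x' * (\<Sum>y\<in>S. k y x * cnj (k y x')))"
    unfolding sum_distrib_left by (intro sum.cong refl sum.swap)
  finally have expand: "of_real (\<Sum>y\<in>S. (cmod (G y))\<^sup>2) =
      (\<Sum>x\<in>E. \<Sum>x'\<in>E. cnj (F x) * F x' * (\<Sum>y\<in>S. k y x * cnj (k y x')))" .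
  have "(\<Sum>y\<in>S. (cmod (G y))\<^sup>2) = cmod (of_real (\<Sum>y\<in>S. (cmod (G y))\<^sup>2))"
    by (subst norm_of_real) (simp add: sum_nonneg)
  also have "\<dots> \<le> (\<Sum>x\<in>E. \<Sum>x'\<in>E. cmod (F x) * cmod (F x') * (if x' = x then D else 0)
                     + \<eta> * (cmod (F x) * cmod (F x')))"
    unfolding expand
  proof (intro sum_norm_le)
    fix x x' assume x: "x \<in> E" "x' \<in> E"
    have "cmod (\<Sum>y\<in>S. k y x * cnj (k y x')) \<le> (if x' = x then D else 0) + \<eta>"
      using diag [OF x(1)] offdiag [OF x] assms(3) by (cases "x = x'") auto
    then have "cmod (F x) * cmod (F x') * cmod (\<Sum>y\<in>S. k y x * cnj (k y x')) \<le>
        cmod (F x) * cmod (F x') * ((if x' = x then D else 0) + \<eta>)"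
      by (intro mult_left_mono) auto
    then show "cmod (cnj (F x) * F x' * (\<Sum>y\<in>S. k y x * cnj (k y x'))) \<le>
        cmod (F x) * cmod (F x') * (if x' = x then D else 0) + \<eta> * (cmod (F x) * cmod (F x'))"
      by (simp add: norm_mult algebra_simps)
  qed
  also have "\<dots> = (\<Sum>x\<in>E. (cmod (F x))\<^sup>2 * D) + (\<Sum>x\<in>E. \<Sum>x'\<in>E. \<eta> * (cmod (F x) * cmod (F x')))"
    using assms(1)
    by (simp add: sum.distrib if_distrib [where f = "(*) _"] power2_eq_square cong: if_cong)
  also have "\<dots> = (\<Sum>x\<in>E. (cmod (F x))\<^sup>2 * D) + \<eta> * (\<Sum>x\<in>E. cmod (F x))\<^sup>2"
    by (simp only: power2_eq_square sum_product) (simp only: sum_distrib_left)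
  also have "\<dots> \<le> D * A + \<eta> * (real (card E) * A)"
    unfolding A_def using sum_squared_le_sum_of_squares [of "\<lambda>x. cmod (F x)" E] assms(3)
    by (intro add_mono mult_left_mono) (auto simp: sum_distrib_left mult_ac)
  also have "\<dots> = (D + \<eta> * real (card E)) * A"
    by (simp add: algebra_simps)
  finally have "(\<Sum>y\<in>S. (cmod (G y))\<^sup>2) \<le> (D + \<eta> * real (card E)) * A" .
  then have "(\<Sum>y\<in>S. (cmod (f y))\<^sup>2) * (\<Sum>y\<in>S. (cmod (G y))\<^sup>2) \<le>
      (\<Sum>y\<in>S. (cmod (f y))\<^sup>2) * ((D + \<eta> * real (card E)) * A)"
    by (intro mult_left_mono) (simp_all add: sum_nonneg)
  with CS have "A * A \<le> (D + \<eta> * real (card E)) * (\<Sum>y\<in>S. (cmod (f y))\<^sup>2) * A"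
    by (simp add: power2_eq_square [of A] mult_ac)
  moreover have "0 \<le> (D + \<eta> * real (card E)) * (\<Sum>y\<in>S. (cmod (f y))\<^sup>2)"
    using assms by (simp add: sum_nonneg)
  ultimately have "A \<le> (D + \<eta> * real (card E)) * (\<Sum>y\<in>S. (cmod (f y))\<^sup>2)"
    using A0 by (cases "A = 0") (auto simp: mult_le_cancel_right)
  then show ?thesis
    by (simp add: A_def F_def)
qed

lemma Lnorm_2: "Lnorm 2 E f = sqrt (\<Sum>x\<in>E. (cmod (f x))\<^sup>2)"
  by (simp add: Lnorm_def powr_half_sqrt sum_nonneg)

lemma sphere_L2norm_nonneg: "0 \<le> sphere_L2norm p j f"
  by (simp add: sphere_L2norm_def sum_nonneg)

text \<open>
  The Gram matrix of the characters \<open>y \<mapsto> \<chi>(y \<cdot> x)\<close> on the sphere is the Fourier transform of the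
  sphere measure at the differences \<open>x - x'\<close>; \<open>\<eta>\<close> is a bound for it after normalisation.
\<close>

lemma Lnorm_extension_le_of_decay:
  assumes "finite E" "0 \<le> \<eta>"
    and offdiag: "\<And>x x'. x \<in> E \<Longrightarrow> x' \<in> E \<Longrightarrow> x \<noteq> x' \<Longrightarrow>
        cmod (\<Sum>y\<in>sphere4 p j. chi p (dot4 y (x - x'))) \<le> \<eta> * real (card (sphere4 p j))"
  shows "Lnorm 2 E (extension p j f) \<le> sqrt (1 + \<eta> * real (card E)) * sphere_L2norm p j f"
proof (cases "sphere4 p j = {}")
  case True
  then show ?thesis
    by (simp add: Lnorm_2 extension_def sphere_L2norm_def)
next
  case False
  let ?S = "sphere4 p j"
  define n where "n = real (card ?S)"
  have n: "n > 0"
    unfolding n_def using False by (simp add: card_gt_0_iff)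
  have dot: "dot4 y x - dot4 y x' = dot4 y (x - x')" for y x x'
    by (simp add: dot4_def sum_subtractf algebra_simps)
  have kernel: "chi p (dot4 y x) * cnj (chi p (dot4 y x')) = chi p (dot4 y (x - x'))" for y x x'
    by (simp add: cnj_chi chi_add [symmetric] dot)
  have "(\<Sum>x\<in>E. (cmod (\<Sum>y\<in>?S. f y * chi p (dot4 y x)))\<^sup>2) \<le>
      (n + \<eta> * n * real (card E)) * (\<Sum>y\<in>?S. (cmod (f y))\<^sup>2)"
  proof (rule almost_orthogonality)
    show "cmod (\<Sum>y\<in>?S. chi p (dot4 y x) * cnj (chi p (dot4 y x))) \<le> n" for x
      unfolding n_def by (rule order_trans [OF norm_sum]) (simp add: norm_mult)
  next
    fix x x' assume "x \<in> E" "x' \<in> E" "x \<noteq> x'"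
    then show "cmod (\<Sum>y\<in>?S. chi p (dot4 y x) * cnj (chi p (dot4 y x'))) \<le> \<eta> * n"
      unfolding kernel n_def by (rule offdiag)
  qed (use assms n in auto)
  then have "(\<Sum>x\<in>E. (cmod (\<Sum>y\<in>?S. f y * chi p (dot4 y x)))\<^sup>2) / n\<^sup>2 \<le>
      (1 + \<eta> * real (card E)) * (1 / n * (\<Sum>y\<in>?S. (cmod (f y))\<^sup>2))"
    using n by (simp add: field_simps power2_eq_square)
  also have "(\<Sum>x\<in>E. (cmod (\<Sum>y\<in>?S. f y * chi p (dot4 y x)))\<^sup>2) / n\<^sup>2 =
      (\<Sum>x\<in>E. (cmod (extension p j f x))\<^sup>2)"
    by (simp add: extension_def n_def norm_divide power_divide flip: sum_divide_distrib)
  finally show ?thesis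
    unfolding Lnorm_2 sphere_L2norm_def n_def real_sqrt_mult [symmetric] by simp
qed

text \<open>
  On a single point there is no off-diagonal term, so \<open>Lnorm_extension_le_of_decay\<close> with \<open>\<eta> = 0\<close> bounds the
  extension pointwise. The estimate serves for the finitely many small primes, and it shows that
  the infimum in \<open>Lambda_sphere\<close> is not taken over an empty set.
\<close>

lemma Lnorm_extension_le_sqrt_card:
  assumes "finite E"
  shows "Lnorm 2 E (extension p j f) \<le> sqrt (real (card E)) * sphere_L2norm p j f"
proof -
  let ?N = "sphere_L2norm p j f"
  have "cmod (extension p j f x) \<le> ?N" for x
    using Lnorm_extension_le_of_decay [of "{x}" 0 p j f] by (simp add: Lnorm_2)
  then have "(\<Sum>x\<in>E. (cmod (extension p j f x))\<^sup>2) \<le> (\<Sum>x\<in>E. ?N\<^sup>2)"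
    by (intro sum_mono power_mono) auto
  then have "Lnorm 2 E (extension p j f) \<le> sqrt (real (card E) * ?N\<^sup>2)"
    unfolding Lnorm_2 by (intro real_sqrt_le_mono) simp
  then show ?thesis
    using sphere_L2norm_nonneg [of p j f] by (simp add: real_sqrt_mult)
qed

text \<open>
  Fourier decay bounds the off-diagonal terms by \<open>2 / p\<close> relative to the size of the sphere. Up to
  \<open>card E = p\<close> their total influence stays bounded, so there is no loss in \<open>p\<close> at all.
\<close>

lemma Lnorm_extension_le_small:
  assumes "prime p" "odd p" "E \<subseteq> Fp4 p" "card E \<le> p"
  shows "Lnorm 2 E (extension p j f) \<le> 2 * sphere_L2norm p j f"
proof -
  have p0: "p > 0" using assms(1) by (simp add: prime_gt_0_nat)
  have "Lnorm 2 E (extension p j f) \<le> sqrt (1 + 2 / real p * real (card E)) * sphere_L2norm p j f"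
  proof (rule Lnorm_extension_le_of_decay)
    fix x x' assume x: "x \<in> E" "x' \<in> E" "x \<noteq> x'"
    then obtain i where i: "x $ i \<noteq> x' $ i"
      by (auto simp: vec_eq_iff)
    have "x $ i \<in> {0..<int p}" "x' $ i \<in> {0..<int p}"
      using x assms(3) by (auto simp: Fp4_def)
    then have "\<not> int p dvd (x - x') $ i"
      using i by (auto dest!: mod_eq_dvd_iff [THEN iffD2])
    then have "cmod (\<Sum>y\<in>sphere4 p j. chi p (dot4 y (x - x'))) \<le> real p ^ 2"
      by (rule norm_sphere_sum_le [OF assms(1,2)])
    also have "\<dots> = real p ^ 3 / real p"
      using p0 by (simp add: power2_eq_square power3_eq_cube)
    also have "\<dots> \<le> 2 * real (card (sphere4 p j)) / real p"
      by (intro divide_right_mono card_sphere4_ge assms(1,2)) simp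
    finally show "cmod (\<Sum>y\<in>sphere4 p j. chi p (dot4 y (x - x'))) \<le> 2 / real p * real (card (sphere4 p j))"
      by simp
  qed (use assms(3) finite_subset_Fp4 in auto)
  also have "\<dots> \<le> sqrt 4 * sphere_L2norm p j f"
  proof (intro mult_right_mono real_sqrt_le_mono sphere_L2norm_nonneg)
    have "real (card E) \<le> real p" using assms(4) by simp
    then show "1 + 2 / real p * real (card E) \<le> 4"
      using p0 by (simp add: field_simps)
  qed
  finally show ?thesis by simp
qed

section \<open>The exponent of the sphere\<close>

lemma half_mem_exponents:
  assumes "p > 0" "0 \<le> \<theta>"
  shows "\<theta> / 2 \<in> {l. 0 \<le> l \<and>
     (\<forall>E f. E \<subseteq> Fp4 p \<and> 1 \<le> card E \<and> real (card E) \<le> real p powr \<theta> \<longrightarrow>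
        Lnorm 2 E (extension p j f) \<le> real p powr l * sphere_L2norm p j f)}"
proof (clarsimp simp: assms(2))
  fix E f assume E: "E \<subseteq> Fp4 p" "real (card E) \<le> real p powr \<theta>"
  have "Lnorm 2 E (extension p j f) \<le> sqrt (real (card E)) * sphere_L2norm p j f"
    using E(1) finite_subset_Fp4 by (intro Lnorm_extension_le_sqrt_card) auto
  also have "\<dots> \<le> sqrt (real p powr \<theta>) * sphere_L2norm p j f"
    using E(2) by (intro mult_right_mono real_sqrt_le_mono sphere_L2norm_nonneg)
  also have "sqrt (real p powr \<theta>) = real p powr (\<theta> / 2)"
    by (simp add: powr_half_sqrt [symmetric] powr_powr)
  finally show "Lnorm 2 E (extension p j f) \<le> real p powr (\<theta> / 2) * sphere_L2norm p j f" .
qed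

lemma Lambda_sphere_nonneg:
  assumes "p > 0" "0 \<le> \<theta>"
  shows "0 \<le> Lambda_sphere p j \<theta>"
  unfolding Lambda_sphere_def
  by (intro cInf_greatest) (use half_mem_exponents [OF assms, of j] in blast, simp)

lemma Lnorm_extension_le_powr:
  assumes "p > 0" "0 \<le> \<theta>" "Lambda_sphere p j \<theta> < l"
    and "E \<subseteq> Fp4 p" "1 \<le> card E" "real (card E) \<le> real p powr \<theta>"
  shows "Lnorm 2 E (extension p j f) \<le> real p powr l * sphere_L2norm p j f"
proof -
  obtain l' where l': "l' < l"
    "Lnorm 2 E (extension p j f) \<le> real p powr l' * sphere_L2norm p j f"
    using cInf_lessD [OF _ assms(3) [unfolded Lambda_sphere_def]] half_mem_exponents [OF assms(1,2)]
      assms(4-6) by blast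
  have "real p powr l' \<le> real p powr l"
    using l'(1) assms(1) by (intro powr_mono) auto
  then show ?thesis
    using l'(2) mult_right_mono [OF _ sphere_L2norm_nonneg] order_trans by blast
qed

section \<open>Removing the loss in the field size\<close>

text \<open>
  Sets with at most \<open>p\<close> elements are covered by Fourier decay. For larger sets
  \<open>\<theta> = log p (card E)\<close> is at least \<open>1\<close>, so the additive errors \<open>\<epsilon>\<close> in the exponent are at most
  \<open>\<epsilon> * \<theta>\<close> and can be absorbed into the slope, raising it from \<open>\<phi>\<close> to \<open>s\<close>.
\<close>

lemma mean_square_bound_of_exponent:
  fixes \<Lambda> :: "real \<Rightarrow> real"
  assumes \<Lambda>: "\<And>\<epsilon>. \<epsilon> > 0 \<Longrightarrow> \<exists>p1::nat. \<forall>p. prime p \<and> odd p \<and> p \<ge> p1 \<longrightarrow>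
      (\<forall>\<theta>\<in>{0..4}. \<forall>j\<in>Fp_units p. Lambda_sphere p j \<theta> \<le> \<Lambda> \<theta> + \<epsilon>)"
    and linear: "\<And>\<theta>. \<theta> \<in> {0<..4} \<Longrightarrow> \<Lambda> \<theta> \<le> \<phi> * \<theta>"
    and "\<phi> < s"
  shows "\<exists>B\<ge>0. \<forall>p j f E. prime p \<and> odd p \<and> j \<in> Fp_units p \<and> E \<subseteq> Fp4 p \<and> E \<noteq> {} \<longrightarrow>
      Lnorm 2 E (extension p j f) \<le> B * real (card E) powr s * sphere_L2norm p j f"
proof -
  \<comment> \<open>The sphere exponents are nonnegative, hence so is \<open>\<phi>\<close>. Thus \<open>s > 0\<close>, and \<open>card E powr s \<ge> 1\<close>
      makes the target bound weaker than a constant one.\<close>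
  have "0 \<le> \<phi> + \<epsilon>" if "\<epsilon> > 0" for \<epsilon>
  proof -
    obtain p1 where p1: "\<And>p \<theta> j. prime p \<Longrightarrow> odd p \<Longrightarrow> p \<ge> p1 \<Longrightarrow> \<theta> \<in> {0..4} \<Longrightarrow>
        j \<in> Fp_units p \<Longrightarrow> Lambda_sphere p j \<theta> \<le> \<Lambda> \<theta> + \<epsilon>"
      using \<Lambda> [OF \<open>\<epsilon> > 0\<close>] by blast
    obtain p where p: "prime p" "p > max p1 2"
      using bigger_prime by blast
    then have "odd p"
      using prime_odd_nat by auto
    then have "Lambda_sphere p 1 1 \<le> \<Lambda> 1 + \<epsilon>"
      using p by (intro p1) (auto simp: Fp_units_def)
    moreover have "0 \<le> Lambda_sphere p 1 1"
      using p by (intro Lambda_sphere_nonneg) auto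
    ultimately show ?thesis
      using linear [of 1] by simp
  qed
  then have "0 \<le> \<phi>"
    by (rule field_le_epsilon)
  then have s: "s > 0" using \<open>\<phi> < s\<close> by simp
  \<comment> \<open>One \<open>\<epsilon>\<close> pays for the error in the hypothesis, the other for passing from the infimum to an
      exponent strictly above it.\<close>
  define \<epsilon> where "\<epsilon> = (s - \<phi>) / 2"
  have \<epsilon>: "\<epsilon> > 0" "\<phi> + 2 * \<epsilon> = s"
    using \<open>\<phi> < s\<close> by (auto simp: \<epsilon>_def field_simps)
  obtain p1 where p1: "\<And>p \<theta> j. prime p \<Longrightarrow> odd p \<Longrightarrow> p \<ge> p1 \<Longrightarrow> \<theta> \<in> {0..4} \<Longrightarrow>
      j \<in> Fp_units p \<Longrightarrow> Lambda_sphere p j \<theta> \<le> \<Lambda> \<theta> + \<epsilon>"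
    using \<Lambda> [OF \<epsilon>(1)] by blast
  \<comment> \<open>The summand \<open>2\<close> is for the sets with at most \<open>p\<close> elements; the other bounds \<open>sqrt (card E)\<close>
      when \<open>p < p1\<close>, since the space has \<open>p ^ 4\<close> points.\<close>
  define B where "B = 2 + real p1 ^ 2"
  have B: "B \<ge> 2"
    by (simp add: B_def)
  have "Lnorm 2 E (extension p j f) \<le> B * real (card E) powr s * sphere_L2norm p j f"
    if p: "prime p" "odd p" and j: "j \<in> Fp_units p" and E: "E \<subseteq> Fp4 p" "E \<noteq> {}" for p j f E
  proof -
    let ?N = "sphere_L2norm p j f"
    have p0: "p > 0" "p > 1" using prime_gt_1_nat [OF p(1)] by simp_all
    have fin: "finite E" using E(1) by (rule finite_subset_Fp4)
    then have card: "1 \<le> card E"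
      using E(2) by (simp add: Suc_le_eq card_gt_0_iff)
    then have ge1: "1 \<le> real (card E) powr s"
      using s by (intro ge_one_powr_ge_zero) auto
    have card4: "card E \<le> p ^ 4"
      using card_mono [OF _ E(1)] by (simp add: card_Fp4)
    consider "card E \<le> p" | "p < p1" | "p \<ge> p1" "card E > p"
      by linarith
    then obtain b where b: "Lnorm 2 E (extension p j f) \<le> b * ?N" "b \<le> B * real (card E) powr s"
    proof cases
      case 1
      have "2 * 1 \<le> B * real (card E) powr s"
        using B ge1 by (intro mult_mono) auto
      then show ?thesis
        using that [OF Lnorm_extension_le_small [OF p E(1) 1]] by simp
    next
      case 2
      have "card E \<le> p1 ^ 4"
        using card4 power_mono [of p p1 4] 2 by linarith
      then have "real (card E) \<le> (real p1 ^ 2) ^ 2"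
        by (simp flip: power_mult of_nat_power)
      then have "sqrt (real (card E)) \<le> real p1 ^ 2"
        by (intro real_le_lsqrt) auto
      also have "\<dots> \<le> B * 1"
        by (simp add: B_def)
      also have "\<dots> \<le> B * real (card E) powr s"
        using B ge1 by (intro mult_left_mono) auto
      finally show ?thesis
        using Lnorm_extension_le_sqrt_card [OF fin] that by blast
    next
      case 3
      define \<theta> where "\<theta> = log (real p) (real (card E))"
      have powr: "real p powr \<theta> = real (card E)"
        unfolding \<theta>_def using p0 card by simp
      have \<theta>1: "1 \<le> \<theta>"
        unfolding \<theta>_def using p0 3 by simp
      have "real (card E) \<le> real p powr 4"
        using card4 p0 by (simp flip: of_nat_power)
      then have \<theta>4: "\<theta> \<le> 4"
        unfolding \<theta>_def using p0 card by (simp add: log_le_iff)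
      have "\<epsilon> * 1 \<le> \<epsilon> * \<theta>"
        using \<epsilon>(1) \<theta>1 by (intro mult_left_mono) auto
      moreover have "Lambda_sphere p j \<theta> \<le> \<phi> * \<theta> + \<epsilon>"
        using p1 [OF p 3(1) _ j, of \<theta>] linear [of \<theta>] \<theta>1 \<theta>4 by simp
      moreover have "\<phi> * \<theta> + 2 * (\<epsilon> * \<theta>) = s * \<theta>"
        unfolding \<epsilon>(2) [symmetric] by (simp add: algebra_simps)
      ultimately have "Lambda_sphere p j \<theta> < s * \<theta>"
        using \<epsilon>(1) by linarith
      then have "Lnorm 2 E (extension p j f) \<le> real p powr (s * \<theta>) * ?N"
        using \<theta>1 p0 card E(1) powr by (intro Lnorm_extension_le_powr) auto
      also have "real p powr (s * \<theta>) = real (card E) powr s"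
        by (simp add: powr [symmetric] powr_powr mult.commute)
      finally show ?thesis
        using B ge1 that by (simp add: mult_le_cancel_right1)
    qed
    show ?thesis
      using b mult_right_mono [OF b(2) sphere_L2norm_nonneg] order_trans by blast
  qed
  then show ?thesis
    using B by (intro exI [of _ B]) auto
qed

text \<open>
  The minimum of \<open>a\<close> over a set of \<open>k\<close> points is at most the root mean square, hence at most
  \<open>M * k powr (s - 1/2)\<close>. Since the hypothesis passes to subsets, one can remove a point with minimal
  value and repeat. The bound is stated with a finite sum; it is uniform in \<open>X\<close> when the exponent
  \<open>(s - 1/2) * r\<close> lies below \<open>-1\<close>.
\<close>

lemma sum_powr_le_of_mean_squares:
  fixes a :: "'a \<Rightarrow> real"
  assumes "finite X" "0 \<le> r" "\<And>x. x \<in> X \<Longrightarrow> 0 \<le> a x"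
    and mean: "\<And>E. E \<subseteq> X \<Longrightarrow> E \<noteq> {} \<Longrightarrow> sqrt (\<Sum>x\<in>E. (a x)\<^sup>2) \<le> M * real (card E) powr s"
  shows "(\<Sum>x\<in>X. a x powr r) \<le> (\<Sum>k=1..card X. (M * real k powr (s - 1 / 2)) powr r)"
  using assms
proof (induction "card X" arbitrary: X)
  case 0
  then show ?case by simp
next
  case (Suc n)
  then have "X \<noteq> {}" by auto
  then have "Min (a ` X) \<in> a ` X"
    using Suc.prems(1) by simp
  then obtain x where x: "x \<in> X" "a x = Min (a ` X)"
    by force
  then have min: "a x \<le> a y" if "y \<in> X" for y
    using Suc.prems(1) that by simp
  let ?n = "real (card X)"
  have n: "?n > 0"
    using Suc.hyps(2) by linarith
  have "sqrt ?n * a x = sqrt (\<Sum>y\<in>X. (a x)\<^sup>2)"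
    using Suc.prems(3) [OF x(1)] by (simp add: real_sqrt_mult)
  also have "\<dots> \<le> sqrt (\<Sum>y\<in>X. (a y)\<^sup>2)"
    using min Suc.prems(3) [OF x(1)] by (intro real_sqrt_le_mono sum_mono power_mono) auto
  also have "\<dots> \<le> M * ?n powr s"
    using Suc.prems(4) \<open>X \<noteq> {}\<close> by blast
  finally have "a x \<le> M * (?n powr s / sqrt ?n)"
    using n by (simp add: field_simps)
  also have "?n powr s / sqrt ?n = ?n powr (s - 1 / 2)"
    using n by (simp add: powr_diff powr_half_sqrt)
  finally have ax: "a x powr r \<le> (M * ?n powr (s - 1 / 2)) powr r"
    using Suc.prems(2) Suc.prems(3) [OF x(1)] by (intro powr_mono2)
  have card: "card (X - {x}) = n"
    using Suc.hyps(2) Suc.prems(1) x(1) by simp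
  have "(\<Sum>y\<in>X - {x}. a y powr r) \<le> (\<Sum>k=1..card (X - {x}). (M * real k powr (s - 1 / 2)) powr r)"
    using Suc.prems card by (intro Suc.hyps(1)) auto
  then show ?case
    using ax Suc.prems(1) x(1) unfolding card Suc.hyps(2) [symmetric]
    by (simp add: sum.remove [of X x])
qed

lemma extension_estimate_of_exponent:
  fixes \<Lambda> :: "real \<Rightarrow> real"
  assumes \<Lambda>: "\<And>\<epsilon>. \<epsilon> > 0 \<Longrightarrow> \<exists>p1::nat. \<forall>p. prime p \<and> odd p \<and> p \<ge> p1 \<longrightarrow>
      (\<forall>\<theta>\<in>{0..4}. \<forall>j\<in>Fp_units p. Lambda_sphere p j \<theta> \<le> \<Lambda> \<theta> + \<epsilon>)"
    and linear: "\<And>\<theta>. \<theta> \<in> {0<..4} \<Longrightarrow> \<Lambda> \<theta> \<le> \<phi> * \<theta>"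
    and \<phi>: "\<phi> < 1 / 2" and r: "r > 2 / (1 - 2 * \<phi>)"
  shows "\<exists>C. \<forall>p j f. prime p \<and> odd p \<and> j \<in> Fp_units p \<longrightarrow>
      Lnorm r (Fp4 p) (extension p j f) \<le> C * sphere_L2norm p j f"
proof -
  have "0 < 2 / (1 - 2 * \<phi>)" using \<phi> by simp
  then have r0: "r > 0" using r by linarith
  have "\<phi> < 1 / 2 - 1 / r"
    using \<phi> r r0 by (simp add: field_simps)
  \<comment> \<open>The upper bound for \<open>s\<close> is equivalent to \<open>(s - 1/2) * r < -1\<close>.\<close>
  then obtain s where s: "\<phi> < s" "s < 1 / 2 - 1 / r"
    using dense by blast
  have "\<exists>B\<ge>0. \<forall>p j f E. prime p \<and> odd p \<and> j \<in> Fp_units p \<and> E \<subseteq> Fp4 p \<and> E \<noteq> {} \<longrightarrow>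
      Lnorm 2 E (extension p j f) \<le> B * real (card E) powr s * sphere_L2norm p j f"
    using \<Lambda> linear s(1) by (rule mean_square_bound_of_exponent)
  then obtain B where "B \<ge> 0" and mean:
    "\<forall>p j f E. prime p \<and> odd p \<and> j \<in> Fp_units p \<and> E \<subseteq> Fp4 p \<and> E \<noteq> {} \<longrightarrow>
      Lnorm 2 E (extension p j f) \<le> B * real (card E) powr s * sphere_L2norm p j f"
    by (elim exE conjE)
  define q where "q = (s - 1 / 2) * r"
  have "q < -1"
    using s(2) r0 by (simp add: q_def field_simps)
  then have summable: "summable (\<lambda>k. real k powr q)"
    by (simp add: summable_real_powr_iff)
  define Z where "Z = (\<Sum>k. real k powr q)"
  have Z: "Z \<ge> 0"
    unfolding Z_def by (rule suminf_nonneg [OF summable]) simp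
  have "Lnorm r (Fp4 p) (extension p j f) \<le> (Z powr (1 / r) * B) * sphere_L2norm p j f"
    if p: "prime p" "odd p" "j \<in> Fp_units p" for p j f
  proof -
    define M where "M = B * sphere_L2norm p j f"
    have M: "M \<ge> 0"
      using \<open>B \<ge> 0\<close> sphere_L2norm_nonneg by (simp add: M_def)
    have "(\<Sum>x\<in>Fp4 p. cmod (extension p j f x) powr r) \<le>
        (\<Sum>k=1..card (Fp4 p). (M * real k powr (s - 1 / 2)) powr r)"
    proof (rule sum_powr_le_of_mean_squares)
      fix E assume "E \<subseteq> Fp4 p" "E \<noteq> {}"
      with mean p have "Lnorm 2 E (extension p j f) \<le> B * real (card E) powr s * sphere_L2norm p j f"
        by blast
      then show "sqrt (\<Sum>x\<in>E. (cmod (extension p j f x))\<^sup>2) \<le> M * real (card E) powr s"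
        by (simp add: Lnorm_2 M_def mult_ac)
    qed (use r0 in auto)
    also have "\<dots> = M powr r * (\<Sum>k=1..card (Fp4 p). real k powr q)"
      using M by (simp add: powr_mult powr_powr q_def sum_distrib_left)
    also have "\<dots> \<le> M powr r * Z"
      unfolding Z_def by (intro mult_left_mono sum_le_suminf summable) auto
    finally have "Lnorm r (Fp4 p) (extension p j f) \<le> (M powr r * Z) powr (1 / r)"
      unfolding Lnorm_def using r0 by (intro powr_mono2) (auto intro: sum_nonneg)
    also have "\<dots> = M * Z powr (1 / r)"
      using M Z r0 by (simp add: powr_mult powr_powr)
    finally show ?thesis
      by (simp add: M_def mult_ac)
  qed
  then show ?thesis by blast
qed

theorem theorem1p4:
  fixes r \<phi> :: real
  assumes "\<phi> < 1 / 2" and "r > 2 / (1 - 2 * \<phi>)"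
  shows "\<exists>C::real. \<forall>\<Lambda> :: real \<Rightarrow> real.
    (\<forall>\<epsilon>>0. \<exists>p1::nat. p1 > 0 \<and>
       (\<forall>p. prime p \<and> odd p \<and> p \<ge> p1 \<longrightarrow>
          (\<forall>\<theta>\<in>{0..4}. (SUP j\<in>Fp_units p. Lambda_sphere p j \<theta>) \<le> \<Lambda> \<theta> + \<epsilon>))) \<and>
    ereal \<phi> = (SUP \<theta>\<in>{0<..4}. ereal (\<Lambda> \<theta> / \<theta>)) \<longrightarrow>
    (\<forall>p j f. prime p \<and> odd p \<and> j \<in> Fp_units p \<longrightarrow>
       Lnorm r (Fp4 p) (extension p j f) \<le> C * sphere_L2norm p j f)"
    (is "\<exists>C. \<forall>\<Lambda>. ?H \<Lambda> \<longrightarrow> ?T C")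
  \<comment> \<open>The constant must serve all \<open>\<Lambda>\<close> at once, although the threshold \<open>p1\<close> depends on \<open>\<Lambda>\<close>. But the
      estimate does not mention \<open>\<Lambda>\<close>, so a constant obtained from one admissible \<open>\<Lambda>\<close> serves them all.\<close>
proof (cases "\<exists>\<Lambda>. ?H \<Lambda>")
  case False
  then show ?thesis by blast
next
  case True
  then obtain \<Lambda> where \<Lambda>: "?H \<Lambda>" ..
  have "\<exists>C. ?T C"
  proof (rule extension_estimate_of_exponent [OF _ _ assms])
    fix \<epsilon> :: real assume "\<epsilon> > 0"
    with \<Lambda> obtain p1 where p1: "\<And>p \<theta>. prime p \<Longrightarrow> odd p \<Longrightarrow> p \<ge> p1 \<Longrightarrow> \<theta> \<in> {0..4} \<Longrightarrow>
        (SUP j\<in>Fp_units p. Lambda_sphere p j \<theta>) \<le> \<Lambda> \<theta> + \<epsilon>"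
      by blast
    have "Lambda_sphere p j \<theta> \<le> (SUP j\<in>Fp_units p. Lambda_sphere p j \<theta>)" if "j \<in> Fp_units p" for p j \<theta>
      using that by (intro cSUP_upper) (auto simp: Fp_units_def)
    then show "\<exists>p1. \<forall>p. prime p \<and> odd p \<and> p \<ge> p1 \<longrightarrow>
        (\<forall>\<theta>\<in>{0..4}. \<forall>j\<in>Fp_units p. Lambda_sphere p j \<theta> \<le> \<Lambda> \<theta> + \<epsilon>)"
      using p1 order_trans by blast
  next
    fix \<theta> :: real assume \<theta>: "\<theta> \<in> {0<..4}"
    then have "ereal (\<Lambda> \<theta> / \<theta>) \<le> ereal \<phi>"
      using \<Lambda> SUP_upper [OF \<theta>, of "\<lambda>\<theta>. ereal (\<Lambda> \<theta> / \<theta>)"] by simp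
    then show "\<Lambda> \<theta> \<le> \<phi> * \<theta>"
      using \<theta> by (simp add: field_simps)
  qed
  then show ?thesis by blast
qed

end
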